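(* Let $n\ge 1$ and consider the homogeneous Kuramoto model on the complete network on $n$ nodes (with any common natural frequency and any coupling constant $k>0$). This model has no non-zero stable fixed point.
   Context: The Kuramoto model on a finite simple undirected network with nodes $1,\ldots,n$ and symmetric $0/1$ adjacency matrix $A=(A_{ij})$ (with $A_{ii}=0$) is the system $$\dot\theta_i=\omega_i+k\sum_{j=1}^n A_{ij}\sin(\theta_j-\theta_i),\qquad i=1,\ldots,n,$$ where the $\theta_i=\theta_i(t)$ are phase angles (taken over the full circle, i.e. range $-\pi$ to $\pi$, modulo $2\pi$), the real constants $\omega_i$ are natural frequencies, and $k>0$ is the coupling constant. Put $\bar\omega=\frac1n\sum_{j=1}^n\omega_j$. The model is homogeneous if all the $\omega_i$ are equal. The complete network is the one with $A_{ij}=1$ for all $i\ne j$. A fixed point (frequency fixed point) is a solution $\{\theta_i^*\}$ of this system with $\dot\theta_i^*(t)=\bar\omega$ for all $i=1,\ldots,n$ (and all $t$); all phase differences $\Delta^*_{ji}=\theta_j^*(t)-\theta_i^*(t)$ are then constant in time. In the homogeneous case, the phase differences of a fixed point satisfy $\sum_{j=1}^n A_{ij}\sin(\Delta^*_{ji})=0$ for all $i$. The zero fixed point is the fixed point in which all phase angle differences are zero (modulo $2\pi$); a non-zero fixed point is a fixed point in which some phase angle difference is non-zero (modulo $2\pi$). A fixed point is called stable if it is (linearly) stable in the following sense: all eigenvalues of the real symmetric $n\times n$ matrix $M$ with entries $$M_{ij}=A_{ij}\cos(\Delta^*_{ji})-\delta_{ij}\sum_{l=1}^n A_{il}\cos(\Delta^*_{li})$$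 are less than or equal to zero (here $\delta_{ij}$ is the Kronecker delta). *)

theory Defs
  imports Complex_Main "HOL-Library.Real_Mod" "Jordan_Normal_Form.Char_Poly"
begin

text \<open>
  Conventions: the nodes \<open>1, \<dots>, n\<close> are numbered \<open>0, \<dots>, n - 1\<close>. Phase angles are
  represented by real-valued differentiable lifts \<open>\<theta> i :: real \<Rightarrow> real\<close> of the circle-valued
  phases, and two phases are identified when they are congruent modulo \<open>2 * pi\<close>. The values of
  \<open>\<theta>\<close> and \<open>\<omega>\<close> at indices \<open>i \<ge> n\<close> play no role.
\<close>

definition network :: "nat \<Rightarrow> real mat \<Rightarrow> bool" where
  "network n A \<longleftrightarrow> A \<in> carrier_mat n n \<and>
     (\<forall>i<n. \<forall>j<n. A $$ (i, j) \<in> {0, 1} \<and> A $$ (i, j) = A $$ (j, i)) \<and>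
     (\<forall>i<n. A $$ (i, i) = 0)"

definition complete_network :: "nat \<Rightarrow> real mat \<Rightarrow> bool" where
  "complete_network n A \<longleftrightarrow> network n A \<and>
     (\<forall>i<n. \<forall>j<n. i \<noteq> j \<longrightarrow> A $$ (i, j) = 1)"

definition homogeneous :: "nat \<Rightarrow> (nat \<Rightarrow> real) \<Rightarrow> bool" where
  "homogeneous n \<omega> \<longleftrightarrow> (\<forall>i<n. \<forall>j<n. \<omega> i = \<omega> j)"

definition mean_frequency :: "nat \<Rightarrow> (nat \<Rightarrow> real) \<Rightarrow> real" where
  "mean_frequency n \<omega> = (1 / real n) * (\<Sum>j<n. \<omega> j)"

definition kuramoto_solution ::
    "nat \<Rightarrow> real mat \<Rightarrow> (nat \<Rightarrow> real) \<Rightarrow> real \<Rightarrow> (nat \<Rightarrow> real \<Rightarrow> real) \<Rightarrow> bool" where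
  "kuramoto_solution n A \<omega> k \<theta> \<longleftrightarrow>
     (\<forall>i<n. \<forall>t. (\<theta> i has_real_derivative
        (\<omega> i + k * (\<Sum>j<n. A $$ (i, j) * sin (\<theta> j t - \<theta> i t)))) (at t))"

definition fixed_point ::
    "nat \<Rightarrow> real mat \<Rightarrow> (nat \<Rightarrow> real) \<Rightarrow> real \<Rightarrow> (nat \<Rightarrow> real \<Rightarrow> real) \<Rightarrow> bool" where
  "fixed_point n A \<omega> k \<theta> \<longleftrightarrow> kuramoto_solution n A \<omega> k \<theta> \<and>
     (\<forall>i<n. \<forall>t. (\<theta> i has_real_derivative mean_frequency n \<omega>) (at t))"

definition phase_diff :: "(nat \<Rightarrow> real \<Rightarrow> real) \<Rightarrow> real \<Rightarrow> nat \<Rightarrow> nat \<Rightarrow> real" where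
  "phase_diff \<theta> t j i = \<theta> j t - \<theta> i t"

text \<open>
  At a fixed point the phase differences are constant, so that it does not matter at which
  time (or at how many times) the conditions below are imposed.
\<close>

lemma fixed_point_phase_diff_constant:
  assumes "fixed_point n A \<omega> k \<theta>" "i < n" "j < n"
  shows "phase_diff \<theta> t j i = phase_diff \<theta> s j i"
proof -
  have "((\<lambda>u. \<theta> j u - \<theta> i u) has_real_derivative
      (mean_frequency n \<omega> - mean_frequency n \<omega>)) (at u)" for u
    using assms by (intro DERIV_diff) (auto simp: fixed_point_def)
  then show ?thesis
    unfolding phase_diff_def by (intro DERIV_isconst_all) auto
qed

definition zero_phases :: "nat \<Rightarrow> (nat \<Rightarrow> real \<Rightarrow> real) \<Rightarrow> bool" where
  "zero_phases n \<theta> \<longleftrightarrow>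
     (\<forall>t. \<forall>i<n. \<forall>j<n. [phase_diff \<theta> t j i = 0] (rmod (2 * pi)))"

definition stability_matrix ::
    "nat \<Rightarrow> real mat \<Rightarrow> (nat \<Rightarrow> real \<Rightarrow> real) \<Rightarrow> real \<Rightarrow> real mat" where
  "stability_matrix n A \<theta> t = mat n n (\<lambda>(i, j).
     A $$ (i, j) * cos (phase_diff \<theta> t j i)
     - (if i = j then \<Sum>l<n. A $$ (i, l) * cos (phase_diff \<theta> t l i) else 0))"

text \<open>The matrix is real symmetric, so all its complex eigenvalues are real.\<close>

definition linearly_stable :: "nat \<Rightarrow> real mat \<Rightarrow> (nat \<Rightarrow> real \<Rightarrow> real) \<Rightarrow> bool" where
  "linearly_stable n A \<theta> \<longleftrightarrow>
     (\<forall>t. \<forall>\<mu>. eigenvalue (stability_matrix n A \<theta> t) \<mu> \<longrightarrow> \<mu> \<le> 0)"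

definition nonzero_stable_fixed_point ::
    "nat \<Rightarrow> real mat \<Rightarrow> (nat \<Rightarrow> real) \<Rightarrow> real \<Rightarrow> (nat \<Rightarrow> real \<Rightarrow> real) \<Rightarrow> bool" where
  "nonzero_stable_fixed_point n A \<omega> k \<theta> \<longleftrightarrow>
     fixed_point n A \<omega> k \<theta> \<and> \<not> zero_phases n \<theta> \<and> linearly_stable n A \<theta>"

end

theory Submission
  imports Defs
begin

text \<open>
  Write \<open>x j\<close> for the phases at some time \<open>t\<close>, and let \<open>\<phi>\<close> be the direction of the
  order parameter, that is, of the complex number with real part \<open>\<Sum>j<n. cos (x j)\<close> and imaginary
  part \<open>\<Sum>j<n. sin (x j)\<close>; let \<open>r \<ge> 0\<close> be its modulus. On the complete network, node \<open>i\<close> is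
  coupled to the others only through the order parameter: its equilibrium equation reads
  \<open>r * sin (\<phi> - x i) = 0\<close>, and the stability matrix is
  \<open>cos (x j - x i)\<close> (positive semidefinite, of rank at most two) minus the diagonal matrix with
  entries \<open>r * cos (x i - \<phi>)\<close>. In each of two cases an explicit eigenvector with a positive
  eigenvalue rules out everything but the zero fixed point.

  If \<open>r = 0\<close>, the diagonal part vanishes, and what is left is a nonzero Gram matrix. An eigenvector
  is \<open>cos (x i - \<psi>)\<close>, where \<open>2 * \<psi>\<close> is the direction of the second-harmonic order
  parameter, that is, of the sum of the unit vectors with angles \<open>2 * x j\<close>; its
  eigenvalue is at least \<open>n / 2\<close> (\<open>incoherent_eigenvector\<close>).

  If \<open>r > 0\<close>, equilibrium forces \<open>\<sigma> i = cos (x i - \<phi>)\<close> to be \<open>1\<close> or \<open>-1\<close>: each node is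
  in phase or in antiphase with the order parameter. The vector \<open>n * \<sigma> i - r\<close> satisfies the
  eigenvector equation for \<open>n\<close> (\<open>aligned_eigenvector\<close>), so that stability forces it to vanish. Then
  all \<open>\<sigma> i\<close> have the sign of \<open>r\<close>, so that all nodes are in phase.
\<close>

section \<open>The stability matrix of the complete network\<close>

lemma complete_network_sum:
  assumes "complete_network n A" and "i < n"
  shows "(\<Sum>j<n. A $$ (i, j) * f j) = (\<Sum>j<n. f j) - f i"
proof -
  have "(\<Sum>j<n. A $$ (i, j) * f j) = (\<Sum>j<n. f j - (if j = i then f j else 0))"
    using assms by (intro sum.cong) (auto simp: complete_network_def network_def)
  also have "\<dots> = (\<Sum>j<n. f j) - f i"
    using assms by (simp add: sum_subtractf)
  finally show ?thesis .
qed

lemma homogeneous_mean_frequency: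
  assumes "homogeneous n \<omega>" and "i < n"
  shows "mean_frequency n \<omega> = \<omega> i"
proof -
  have "(\<Sum>j<n. \<omega> j) = (\<Sum>j<n. \<omega> i)"
    using assms unfolding homogeneous_def by (intro sum.cong refl) blast
  then show ?thesis
    using assms by (simp add: mean_frequency_def)
qed

lemma fixed_point_equilibrium:
  assumes "complete_network n A" "homogeneous n \<omega>" "k > 0"
    and "fixed_point n A \<omega> k \<theta>" and "i < n"
  shows "(\<Sum>j<n. sin (\<theta> j t - \<theta> i t)) = 0"
proof -
  let ?S = "\<Sum>j<n. A $$ (i, j) * sin (\<theta> j t - \<theta> i t)"
  have "(\<theta> i has_real_derivative (\<omega> i + k * ?S)) (at t)"
    and "(\<theta> i has_real_derivative \<omega> i) (at t)"
    using assms homogeneous_mean_frequency[of n \<omega> i]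
    by (auto simp: fixed_point_def kuramoto_solution_def)
  then have "\<omega> i + k * ?S = \<omega> i"
    by (rule DERIV_unique)
  then have "?S = 0"
    using \<open>k > 0\<close> by simp
  then show ?thesis
    using complete_network_sum[OF assms(1,5), of "\<lambda>j. sin (\<theta> j t - \<theta> i t)"] by simp
qed

text \<open>
  The missing self-coupling \<open>A $$ (i, i) = 0\<close> cancels: including the term \<open>cos 0 = 1\<close> in the row sum
  changes the diagonal entry by the same amount as including it in the adjacency part.
\<close>

lemma complete_stability_matrix_entry:
  assumes "complete_network n A" and "i < n" "j < n"
  shows "stability_matrix n A \<theta> t $$ (i, j) =
    cos (\<theta> j t - \<theta> i t) - (if i = j then \<Sum>l<n. cos (\<theta> l t - \<theta> i t) else 0)"
proof -
  have "A $$ (i, j) = (if i = j then 0 else 1)"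
    using assms unfolding complete_network_def network_def by metis
  then show ?thesis
    using assms(2,3) complete_network_sum[OF assms(1,2), of "\<lambda>l. cos (\<theta> l t - \<theta> i t)"]
    by (cases "i = j") (simp_all add: stability_matrix_def phase_diff_def)
qed

lemma complete_stability_eigenvalue:
  assumes "complete_network n A"
    and eq: "\<And>i. i < n \<Longrightarrow> (\<Sum>j<n. cos (\<theta> j t - \<theta> i t) * v j)
               - (\<Sum>l<n. cos (\<theta> l t - \<theta> i t)) * v i = \<mu> * v i"
    and nz: "m < n" "v m \<noteq> 0"
  shows "eigenvalue (stability_matrix n A \<theta> t) \<mu>"
proof -
  let ?M = "stability_matrix n A \<theta> t"
  have dim: "dim_row ?M = n" "dim_col ?M = n"
    by (auto simp: stability_matrix_def)
  have "(?M *\<^sub>v vec n v) $ i = (\<mu> \<cdot>\<^sub>v vec n v) $ i" if "i < n" for i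
  proof -
    have "(?M *\<^sub>v vec n v) $ i = (\<Sum>j<n. ?M $$ (i, j) * v j)"
      using that dim by (simp add: scalar_prod_def atLeast0LessThan)
    also have "\<dots> = (\<Sum>j<n. cos (\<theta> j t - \<theta> i t) * v j
        - (if j = i then (\<Sum>l<n. cos (\<theta> l t - \<theta> i t)) * v i else 0))"
      by (intro sum.cong)
        (auto simp: complete_stability_matrix_entry[OF assms(1) that] left_diff_distrib)
    also have "\<dots> = \<mu> * v i"
      using eq[OF that] that by (simp add: sum_subtractf)
    finally show ?thesis
      using that by simp
  qed
  then have "?M *\<^sub>v vec n v = \<mu> \<cdot>\<^sub>v vec n v"
    using dim by (intro eq_vecI) auto
  moreover have "vec n v \<noteq> 0\<^sub>v n"
    using nz by (metis index_vec index_zero_vec(1))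
  ultimately show ?thesis
    unfolding eigenvalue_def eigenvector_def using dim
    by (intro exI[of _ "vec n v"]) auto
qed

section \<open>Rotating by the direction of the order parameter\<close>

text \<open>
  The angle is the argument of the sum of the unit vectors \<open>cis (x j)\<close>: after rotation by it, this
  sum is a nonnegative real number.
\<close>

lemma order_parameter_direction:
  fixes x :: "'a \<Rightarrow> real"
  obtains \<phi> where "(\<Sum>j\<in>J. sin (x j - \<phi>)) = 0" and "(\<Sum>j\<in>J. cos (x j - \<phi>)) \<ge> 0"
proof
  define z where "z = (\<Sum>j\<in>J. cis (x j))"
  have "(\<Sum>j\<in>J. cis (x j - Arg z)) = z * cis (- Arg z)"
    by (simp add: z_def sum_distrib_right cis_mult)
  also have "z * cis (- Arg z) = rcis (cmod z) (Arg z) * cis (- Arg z)"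
    by (simp add: rcis_cmod_Arg)
  also have "\<dots> = of_real (cmod z)"
    by (simp add: rcis_def cis_mult mult.assoc)
  finally have eq: "(\<Sum>j\<in>J. cis (x j - Arg z)) = of_real (cmod z)" .
  show "(\<Sum>j\<in>J. sin (x j - Arg z)) = 0"
    using arg_cong[OF eq, of Im] by simp
  show "(\<Sum>j\<in>J. cos (x j - Arg z)) \<ge> 0"
    using arg_cong[OF eq, of Re] by simp
qed

lemma sum_sin_rotate:
  fixes x :: "'a \<Rightarrow> real"
  assumes "(\<Sum>j\<in>J. sin (x j - \<phi>)) = 0"
  shows "(\<Sum>j\<in>J. sin (x j - y)) = - (\<Sum>j\<in>J. cos (x j - \<phi>)) * sin (y - \<phi>)"
proof -
  have "sin (x j - y) = sin (x j - \<phi>) * cos (y - \<phi>) - cos (x j - \<phi>) * sin (y - \<phi>)" for j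
    using sin_diff[of "x j - \<phi>" "y - \<phi>"] by simp
  then show ?thesis
    using assms by (simp add: sum_subtractf flip: sum_distrib_right)
qed

lemma sum_cos_rotate:
  fixes x :: "'a \<Rightarrow> real"
  assumes "(\<Sum>j\<in>J. sin (x j - \<phi>)) = 0"
  shows "(\<Sum>j\<in>J. cos (x j - y)) = (\<Sum>j\<in>J. cos (x j - \<phi>)) * cos (y - \<phi>)"
proof -
  have "cos (x j - y) = cos (x j - \<phi>) * cos (y - \<phi>) + sin (x j - \<phi>) * sin (y - \<phi>)" for j
    using cos_diff[of "x j - \<phi>" "y - \<phi>"] by simp
  then show ?thesis
    using assms by (simp add: sum.distrib flip: sum_distrib_right)
qed

section \<open>Eigenvectors with positive eigenvalue\<close>

text \<open>
  The product formula turns \<open>2 * cos (x j - y) * cos (x j - \<psi>)\<close> into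
  \<open>cos (2 * x j - (y + \<psi>)) + cos (y - \<psi>)\<close>. Summed over \<open>j\<close>, the first term is a multiple of
  \<open>cos (y - \<psi>)\<close> as well, because \<open>2 * \<psi>\<close> is the direction of the second harmonic.
\<close>

lemma incoherent_eigenvector:
  fixes x :: "nat \<Rightarrow> real"
  assumes "(\<Sum>j<n. sin (2 * x j - 2 * \<psi>)) = 0"
  shows "(\<Sum>j<n. cos (x j - y) * cos (x j - \<psi>)) =
    ((real n + (\<Sum>j<n. cos (2 * x j - 2 * \<psi>))) / 2) * cos (y - \<psi>)"
proof -
  have "cos (x j - y) * cos (x j - \<psi>) = (cos (2 * x j - (y + \<psi>)) + cos (y - \<psi>)) / 2" for j
    using cos_times_cos[of "x j - \<psi>" "x j - y"] by (simp add: algebra_simps)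
  then have "(\<Sum>j<n. cos (x j - y) * cos (x j - \<psi>)) =
      ((\<Sum>j<n. cos (2 * x j - (y + \<psi>))) + real n * cos (y - \<psi>)) / 2"
    by (simp only: sum.distrib flip: sum_divide_distrib) simp
  also have "(\<Sum>j<n. cos (2 * x j - (y + \<psi>))) =
      (\<Sum>j<n. cos (2 * x j - 2 * \<psi>)) * cos (y - \<psi>)"
    using sum_cos_rotate[of "\<lambda>j. 2 * x j" "2 * \<psi>" "{..<n}" "y + \<psi>"] assms by simp
  finally show ?thesis
    by (simp add: algebra_simps)
qed

lemma stable_imp_coherent:
  assumes "n \<ge> 1" "complete_network n A" "linearly_stable n A \<theta>"
    and sin0: "(\<Sum>j<n. sin (\<theta> j t - \<phi>)) = 0"
  shows "(\<Sum>j<n. cos (\<theta> j t - \<phi>)) \<noteq> 0"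
proof
  assume r0: "(\<Sum>j<n. cos (\<theta> j t - \<phi>)) = 0"
  define x where "x j = \<theta> j t" for j
  obtain \<xi> where \<xi>: "(\<Sum>j<n. sin (2 * x j - \<xi>)) = 0" "(\<Sum>j<n. cos (2 * x j - \<xi>)) \<ge> 0"
    by (rule order_parameter_direction)
  define \<psi> where "\<psi> = \<xi> / 2"
  define \<beta> where "\<beta> = (\<Sum>j<n. cos (2 * x j - 2 * \<psi>))"
  have \<psi>: "(\<Sum>j<n. sin (2 * x j - 2 * \<psi>)) = 0" and "\<beta> \<ge> 0"
    using \<xi> by (simp_all add: \<psi>_def \<beta>_def)
  let ?\<mu> = "(real n + \<beta>) / 2"
  have "?\<mu> > 0"
    using \<open>n \<ge> 1\<close> \<open>\<beta> \<ge> 0\<close> by simp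
  \<comment> \<open>At the angle \<open>y = \<psi>\<close> the eigenvector equation gives the squared norm of the vector, so it is nonzero.\<close>
  have "(\<Sum>j<n. cos (x j - \<psi>) * cos (x j - \<psi>)) = ?\<mu>"
    using incoherent_eigenvector[OF \<psi>, of \<psi>] by (simp add: \<beta>_def)
  then have "(\<Sum>j<n. cos (x j - \<psi>) * cos (x j - \<psi>)) \<noteq> 0"
    using \<open>?\<mu> > 0\<close> by linarith
  then obtain m where m: "m < n" "cos (x m - \<psi>) \<noteq> 0"
    by (auto elim: sum.not_neutral_contains_not_neutral)
  have "(\<Sum>j<n. cos (x j - x i) * cos (x j - \<psi>))
      - (\<Sum>l<n. cos (x l - x i)) * cos (x i - \<psi>) = ?\<mu> * cos (x i - \<psi>)" for i
    using incoherent_eigenvector[OF \<psi>, of "x i"] sum_cos_rotate[OF sin0, of "x i"] r0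
    by (simp add: \<beta>_def x_def)
  then have "eigenvalue (stability_matrix n A \<theta> t) ?\<mu>"
    using m unfolding x_def
    by (intro complete_stability_eigenvalue[OF assms(2), where v = "\<lambda>j. cos (\<theta> j t - \<psi>)" and m = m])
  then show False
    using assms(3) \<open>?\<mu> > 0\<close> unfolding linearly_stable_def by (meson not_less)
qed

text \<open>
  The matrix with entries \<open>\<sigma> i * \<sigma> j\<close> minus the diagonal matrix with entries \<open>r * \<sigma> i\<close> preserves
  the space of the vectors that are constant on each of the two sign classes. Constant vectors are
  in its kernel, and their orthogonal complement in that space is spanned by \<open>n * \<sigma> i - r\<close>, which
  is therefore an eigenvector whenever both signs occur.
\<close>

lemma aligned_eigenvector:
  fixes \<sigma> :: "nat \<Rightarrow> real"
  assumes sq: "\<And>i. i < n \<Longrightarrow> \<sigma> i * \<sigma> i = 1" and r: "r = (\<Sum>j<n. \<sigma> j)" and "i < n"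
  shows "(\<Sum>j<n. \<sigma> i * \<sigma> j * (n * \<sigma> j - r)) - r * \<sigma> i * (n * \<sigma> i - r) = n * (n * \<sigma> i - r)"
proof -
  have "(\<Sum>j<n. \<sigma> i * \<sigma> j * (n * \<sigma> j - r)) = (\<Sum>j<n. \<sigma> i * n - \<sigma> i * r * \<sigma> j)"
  proof (rule sum.cong)
    fix j assume "j \<in> {..<n}"
    then have "\<sigma> i * \<sigma> j * (n * \<sigma> j) = \<sigma> i * n"
      using sq[of j] by (simp add: mult.assoc mult.left_commute)
    then show "\<sigma> i * \<sigma> j * (n * \<sigma> j - r) = \<sigma> i * n - \<sigma> i * r * \<sigma> j"
      by (simp add: algebra_simps)
  qed simp
  also have "\<dots> = n * (\<sigma> i * n) - \<sigma> i * r * r"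
    by (simp add: sum_subtractf r flip: sum_distrib_left)
  moreover have "r * \<sigma> i * (n * \<sigma> i - r) = r * n - \<sigma> i * r * r"
    using sq[OF \<open>i < n\<close>] by (simp add: algebra_simps)
  ultimately show ?thesis
    by (simp add: algebra_simps)
qed

text \<open>
  Stability forces the eigenvector \<open>n * \<sigma> i - r\<close> for \<open>n\<close> to vanish, so that
  \<open>\<sigma> i = r / n\<close> does not depend on \<open>i\<close>.
\<close>

lemma stable_equilibrium_in_phase:
  assumes "complete_network n A" "linearly_stable n A \<theta>"
    and equilibrium: "\<And>i. i < n \<Longrightarrow> (\<Sum>j<n. sin (\<theta> j t - \<theta> i t)) = 0"
    and "i < n" "j < n"
  shows "cos (\<theta> j t - \<theta> i t) = 1"
proof -
  have "n \<ge> 1"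
    using \<open>i < n\<close> by simp
  define x where "x l = \<theta> l t" for l
  obtain \<phi> where \<phi>: "(\<Sum>l<n. sin (x l - \<phi>)) = 0" "(\<Sum>l<n. cos (x l - \<phi>)) \<ge> 0"
    by (rule order_parameter_direction)
  define \<sigma> where "\<sigma> l = cos (x l - \<phi>)" for l
  define r where "r = (\<Sum>l<n. \<sigma> l)"
  have "r \<noteq> 0"
    using stable_imp_coherent[OF \<open>n \<ge> 1\<close> assms(1,2), of t \<phi>] \<phi>
    by (simp add: r_def \<sigma>_def x_def)
  then have "r > 0"
    using \<phi>(2) by (simp add: r_def \<sigma>_def)
  have sin0: "sin (x l - \<phi>) = 0" if "l < n" for l
    using sum_sin_rotate[OF \<phi>(1), of "x l"] equilibrium[OF that] \<open>r \<noteq> 0\<close>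
    by (simp add: r_def \<sigma>_def x_def)
  have sq: "\<sigma> l * \<sigma> l = 1" if "l < n" for l
    using sin_cos_squared_add3[of "x l - \<phi>"] sin0[OF that] by (simp add: \<sigma>_def)
  have cos_diff_eq: "cos (x m - x l) = \<sigma> l * \<sigma> m" if "l < n" for l m
    using cos_diff[of "x m - \<phi>" "x l - \<phi>"] sin0[OF that] by (simp add: \<sigma>_def)
  have "\<sigma> m = r / n" if "m < n" for m
  proof (rule ccontr)
    assume "\<sigma> m \<noteq> r / n"
    then have "n * \<sigma> m - r \<noteq> 0"
      using \<open>n \<ge> 1\<close> by (simp add: field_simps)
    moreover have "(\<Sum>j<n. cos (x j - x l) * (n * \<sigma> j - r))
        - (\<Sum>j<n. cos (x j - x l)) * (n * \<sigma> l - r) = n * (n * \<sigma> l - r)" if "l < n" for l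
      using aligned_eigenvector[OF sq r_def that] sum_cos_rotate[OF \<phi>(1), of "x l"]
        cos_diff_eq[OF that]
      by (simp add: r_def \<sigma>_def)
    ultimately have "eigenvalue (stability_matrix n A \<theta> t) n"
      using \<open>m < n\<close> unfolding x_def
      by (intro complete_stability_eigenvalue[OF assms(1), where v = "\<lambda>j. n * \<sigma> j - r" and m = m])
    then have "real n \<le> 0"
      using assms(2) unfolding linearly_stable_def by blast
    then show False
      using \<open>n \<ge> 1\<close> by simp
  qed
  then have "\<sigma> j = \<sigma> i"
    using \<open>i < n\<close> \<open>j < n\<close> by simp
  then show ?thesis
    using cos_diff_eq[of i j] sq[OF \<open>i < n\<close>] \<open>i < n\<close> by (simp add: x_def)
qed

theorem theorem4p1:
  fixes n :: nat and A :: "real mat" and \<omega> :: "nat \<Rightarrow> real" and k :: real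
  assumes "n \<ge> 1"
    and "complete_network n A"
    and "homogeneous n \<omega>"
    and "k > 0"
  shows "\<not> (\<exists>\<theta>. nonzero_stable_fixed_point n A \<omega> k \<theta>)"
proof
  assume "\<exists>\<theta>. nonzero_stable_fixed_point n A \<omega> k \<theta>"
  then obtain \<theta> where fp: "fixed_point n A \<omega> k \<theta>" and nz: "\<not> zero_phases n \<theta>"
    and stable: "linearly_stable n A \<theta>"
    by (auto simp: nonzero_stable_fixed_point_def)
  have "[phase_diff \<theta> t j i = 0] (rmod (2 * pi))" if "i < n" "j < n" for t i j
  proof -
    have "cos (\<theta> j t - \<theta> i t) = 1"
      using stable_equilibrium_in_phase[OF assms(2) stable _ that]
        fixed_point_equilibrium[OF assms(2-4) fp] by blast
    then obtain q :: int where "\<theta> j t - \<theta> i t = of_int q * 2 * pi"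
      by (auto simp: cos_one_2pi_int)
    then show ?thesis
      by (auto simp: phase_diff_def rcong_altdef intro: exI[of _ "- q"])
  qed
  then show False
    using nz by (simp add: zero_phases_def)
qed

end
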